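(* The exponential generating function $C_2(z)=\sum_{n\ge0}c_{2,n}\frac{z^n}{n!}$ of compacted trees of right height at most $2$ is D-finite and satisfies $$(z^2-3z+1)C_2'''(z)-(z^2-6z+6)C_2''(z)-(2z-3)C_2'(z)=0,\qquad C_2(0)=1,\ C_2'(0)=1,\ C_2''(0)=3.$$
   Context: A full binary tree is a rooted plane tree whose nodes have $0$ or $2$ ordered children; a fringe subtree is a node with all its descendants. The compacted tree of a full binary tree $T$ is the DAG obtained by post-order traversal (left, right, node), replacing each edge leading to a fringe subtree identical to one seen earlier by a pointer to the first occurrence and deleting the duplicate. Its size is the number of its internal nodes; distinct $T$ give distinct compacted trees. The spine is the compacted tree with pointers and the leaf removed; the right height is the maximal number of right spine edges on a path from the root to a spine node. $c_{2,n}$ counts compacted trees of size $n$ with right height at most $2$. *)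

theory Defs
  imports
    Complex_Main
    "HOL-Library.Tree"
    "HOL-Computational_Algebra.Polynomial_FPS"
begin

section \<open>Full binary trees and their compaction\<close>

datatype full_tree = FLeaf | FNode full_tree full_tree

text \<open>
  The DAG is written as a plane tree unfolded along its non-pointer edges: \<open>CLeaf\<close> is the unique
  leaf, \<open>CNode l r\<close> an internal node, and \<open>CPtr i\<close> in a child position says that this
  child edge is a pointer to the \<open>i\<close>-th node of the DAG, where the nodes (internal nodes and
  the leaf) are numbered from 0 in post-order.
\<close>

datatype compacted_tree = CLeaf | CPtr nat | CNode compacted_tree compacted_tree

definition first_index :: "'a list \<Rightarrow> 'a \<Rightarrow> nat" where
  "first_index xs x = length (takeWhile (\<lambda>y. y \<noteq> x) xs)"

text \<open>
  The list \<open>seen\<close> holds the distinct fringe subtrees met so far, in post-order of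
  their first occurrence; the updated list is returned. Testing membership on entering a
  subtree \<open>t\<close> rather than on leaving it makes no difference: the subtrees visited in between
  are proper subtrees of \<open>t\<close>, hence different from \<open>t\<close>, and if \<open>t\<close> is a duplicate then all of
  them have been seen already and are deleted together with \<open>t\<close>.
\<close>

fun compact_aux :: "full_tree list \<Rightarrow> full_tree \<Rightarrow> compacted_tree \<times> full_tree list" where
  "compact_aux seen FLeaf =
     (if FLeaf \<in> set seen then (CPtr (first_index seen FLeaf), seen)
      else (CLeaf, seen @ [FLeaf]))"
| "compact_aux seen (FNode l r) =
     (if FNode l r \<in> set seen then (CPtr (first_index seen (FNode l r)), seen)
      else (let (l', seen1) = compact_aux seen l;
                (r', seen2) = compact_aux seen1 r
            in (CNode l' r', seen2 @ [FNode l r])))"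

definition compact_tree :: "full_tree \<Rightarrow> compacted_tree" where
  "compact_tree t = fst (compact_aux [] t)"

fun csize :: "compacted_tree \<Rightarrow> nat" where
  "csize CLeaf = 0"
| "csize (CPtr i) = 0"
| "csize (CNode l r) = Suc (csize l + csize r)"


section \<open>Spine and right height\<close>

text \<open>In the spine, the constructor \<open>Leaf\<close> of the library type stands for an absent child.\<close>

fun spine :: "compacted_tree \<Rightarrow> unit tree" where
  "spine CLeaf = Leaf"
| "spine (CPtr i) = Leaf"
| "spine (CNode l r) = Node (spine l) () (spine r)"

text \<open>For each node of the tree, the number of right edges on the path from the root to it.\<close>

fun right_depths :: "'a tree \<Rightarrow> nat set" where
  "right_depths Leaf = {}"
| "right_depths (Node l x r) = insert 0 (right_depths l \<union> Suc ` right_depths r)"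

text \<open>The inserted 0 only matters for the empty spine, whose right height is 0 by convention.\<close>

definition right_height :: "compacted_tree \<Rightarrow> nat" where
  "right_height c = Max (insert 0 (right_depths (spine c)))"


section \<open>Counting sequence and generating function\<close>

definition compacted_count :: "nat \<Rightarrow> nat \<Rightarrow> nat" where
  "compacted_count k n = card {c \<in> range compact_tree. csize c = n \<and> right_height c \<le> k}"

definition compacted_egf :: "nat \<Rightarrow> real fps" where
  "compacted_egf k = Abs_fps (\<lambda>n. real (compacted_count k n) / fact n)"

definition D_finite :: "'a::field_char_0 fps \<Rightarrow> bool" where
  "D_finite f \<longleftrightarrow>
     (\<exists>(r::nat) (p :: nat \<Rightarrow> 'a poly). p r \<noteq> 0 \<and>
        (\<Sum>i\<le>r. fps_of_poly (p i) * (fps_deriv ^^ i) f) = 0)"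

end

theory Submission
  imports Defs
begin

text \<open>
  A compacted tree determines its full binary tree, so trees are counted instead. With \<open>k\<close> internal
  nodes seen so far, a pointer has \<open>k + 1\<close> targets, and a new node is an arbitrary pair of
  consecutively built children, except that the \<open>k\<close> pairs belonging to known nodes are forbidden.
  Peeling off the root turns this into a recurrence in the right height \<open>h\<close>, linear once the tree
  below the root's left edge is regarded as an input. On exponential generating functions, the
  operators \<open>A h\<close> that append a subtree of right height at most \<open>h\<close> satisfy
  \<open>(D - A h) A (h + 1) = D + D z D - z D\<close> with \<open>A (-1) = 1 + z D\<close>, and
  \<open>C2' = A 1 C2\<close>; eliminating \<open>A 1\<close> and \<open>A 0\<close> gives the differential equation.
\<close>

section \<open>Compacted trees determine their trees\<close>

lemma first_index_inj:
  assumes "x \<in> set xs" "y \<in> set xs" "first_index xs x = first_index xs y"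
  shows "x = y"
proof -
  have nth: "xs ! first_index xs z = z" if "z \<in> set xs" for z
    using that by (induction xs) (auto simp: first_index_def)
  show ?thesis using nth[OF assms(1)] nth[OF assms(2)] assms(3) by metis
qed

lemma fst_compact_aux_eq_CPtr_iff:
  "fst (compact_aux seen t) = CPtr i \<longleftrightarrow> t \<in> set seen \<and> i = first_index seen t"
  by (cases t) (auto simp: split_def Let_def)

text \<open>A pointer is decoded by \<open>first_index_inj\<close>. For a new node the left children
  are identified first; only then are both right children compacted from the same list.\<close>

lemma fst_compact_aux_inj:
  "fst (compact_aux seen t) = fst (compact_aux seen t') \<Longrightarrow> t = t'"
proof (induction t arbitrary: seen t')
  case (FLeaf seen t')
  show ?case
  proof (cases "FLeaf \<in> set seen")
    case True
    then have "fst (compact_aux seen t') = CPtr (first_index seen FLeaf)"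
      using FLeaf by simp
    then show ?thesis
      using True unfolding fst_compact_aux_eq_CPtr_iff by (metis first_index_inj)
  next
    case False
    then show ?thesis using FLeaf by (cases t') (auto simp: split_def Let_def split: if_splits)
  qed
next
  case (FNode l r seen t')
  show ?case
  proof (cases "FNode l r \<in> set seen")
    case True
    then have "fst (compact_aux seen t') = CPtr (first_index seen (FNode l r))"
      using FNode.prems by simp
    then show ?thesis
      using True unfolding fst_compact_aux_eq_CPtr_iff by (metis first_index_inj)
  next
    case False
    then obtain l' r' where t': "t' = FNode l' r'" "t' \<notin> set seen"
      using FNode.prems by (cases t') (auto simp: split_def Let_def split: if_splits)
    have eq: "fst (compact_aux seen l) = fst (compact_aux seen l')"
      "fst (compact_aux (snd (compact_aux seen l)) r) = fst (compact_aux (snd (compact_aux seen l')) r')"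
      using False FNode.prems t' by (auto simp: split_def Let_def)
    have "l = l'" by (rule FNode.IH(1)[OF eq(1)])
    moreover have "r = r'" by (rule FNode.IH(2)[OF eq(2)[folded \<open>l = l'\<close>]])
    ultimately show ?thesis using t' by simp
  qed
qed

lemma size_spine: "size (spine c) = csize c"
  by (induction c) auto

lemma finite_right_depths: "finite (right_depths t)"
  by (induction t) auto

lemma right_height_le_iff: "right_height c \<le> k \<longleftrightarrow> right_depths (spine c) \<subseteq> {..<Suc k}"
  by (auto simp: right_height_def finite_right_depths less_Suc_eq_le)


section \<open>Counting the trees with a given set of known fringe subtrees\<close>

definition new_spine :: "full_tree list \<Rightarrow> full_tree \<Rightarrow> unit tree" where
  "new_spine seen t = spine (fst (compact_aux seen t))"

definition seen_after :: "full_tree list \<Rightarrow> full_tree \<Rightarrow> full_tree list" where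
  "seen_after seen t = snd (compact_aux seen t)"

lemma new_spine_FNode:
  "FNode l r \<notin> set seen \<Longrightarrow>
   new_spine seen (FNode l r) = Node (new_spine seen l) () (new_spine (seen_after seen l) r)"
  by (auto simp: new_spine_def seen_after_def split_def Let_def)

lemma seen_after_FNode:
  "FNode l r \<notin> set seen \<Longrightarrow>
   seen_after seen (FNode l r) = seen_after (seen_after seen l) r @ [FNode l r]"
  by (auto simp: seen_after_def split_def Let_def)

text \<open>Starting with the leaf already known only replaces the leaf by a pointer.\<close>

lemma start_with_leaf:
  "new_spine [] t = new_spine [FLeaf] t \<and> seen_after [] t = seen_after [FLeaf] t"
proof (induction t)
  case FLeaf
  then show ?case by (simp add: new_spine_def seen_after_def)
next
  case (FNode l r)
  then show ?case by (simp add: new_spine_FNode seen_after_FNode)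
qed

section \<open>States of the traversal and their growth\<close>

lemma known_subtree:
  assumes "t \<in> set seen"
  shows "new_spine seen t = Leaf" "seen_after seen t = seen"
proof -
  have "compact_aux seen t = (CPtr (first_index seen t), seen)"
    by (cases t) (use assms in simp_all)
  then show "new_spine seen t = Leaf" "seen_after seen t = seen"
    by (simp_all add: new_spine_def seen_after_def)
qed

lemma new_spine_eq_Leaf_iff:
  assumes "FLeaf \<in> set seen"
  shows "new_spine seen t = Leaf \<longleftrightarrow> t \<in> set seen"
proof
  assume "new_spine seen t = Leaf"
  then show "t \<in> set seen"
    by (cases t) (use assms new_spine_FNode[of _ _ seen] in force)+
qed (rule known_subtree(1))

text \<open>The invariant of the traversal. Closure under children makes each known internal node
  one forbidden pair of pointers.\<close>

definition valid_seen :: "full_tree list \<Rightarrow> bool" where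
  "valid_seen seen \<longleftrightarrow> distinct seen \<and> FLeaf \<in> set seen \<and>
     (\<forall>l r. FNode l r \<in> set seen \<longrightarrow> l \<in> set seen \<and> r \<in> set seen)"

text \<open>Unfolding \<open>valid_seen\<close> in the simplifier loops, because its closure condition can be applied to
  its own premise; hence the following rules.\<close>

lemma valid_seenD:
  assumes "valid_seen seen"
  shows "distinct seen" "FLeaf \<in> set seen"
    "FNode l r \<in> set seen \<Longrightarrow> l \<in> set seen" "FNode l r \<in> set seen \<Longrightarrow> r \<in> set seen"
  using assms unfolding valid_seen_def by metis+

lemma valid_seen_snoc:
  assumes "valid_seen seen" "l \<in> set seen" "r \<in> set seen" "FNode l r \<notin> set seen"
  shows "valid_seen (seen @ [FNode l r])"
  unfolding valid_seen_def
proof (intro conjI allI impI)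
  fix l' r' assume "FNode l' r' \<in> set (seen @ [FNode l r])"
  then have "FNode l' r' \<in> set seen \<or> l' = l \<and> r' = r" by auto
  then have "l' \<in> set seen \<and> r' \<in> set seen"
    using assms(2,3) valid_seenD(3,4)[OF assms(1), of l' r'] by metis
  then show "l' \<in> set (seen @ [FNode l r])" "r' \<in> set (seen @ [FNode l r])"
    by simp_all
qed (use assms(4) valid_seenD(1,2)[OF assms(1)] in simp_all)

text \<open>Only fringe subtrees of \<open>t\<close> are appended. By size, a new node is therefore
  still unrecorded once its two children have been processed.\<close>

lemma seen_after_size:
  "s \<in> set (seen_after seen t) \<Longrightarrow> s \<in> set seen \<or> size s \<le> size t"
proof (induction t arbitrary: seen)
  case FLeaf
  then show ?case by (auto simp: seen_after_def split: if_splits)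
next
  case (FNode l r)
  show ?case
  proof (cases "FNode l r \<in> set seen")
    case True
    then show ?thesis using FNode.prems by (simp add: known_subtree)
  next
    case False
    then show ?thesis
      using FNode.prems FNode.IH(1)[of seen] FNode.IH(2)[of "seen_after seen l"]
      by (auto simp: seen_after_FNode)
  qed
qed

text \<open>Each spine node appends exactly one subtree, so spine sizes translate into numbers of
  pointer targets.\<close>

lemma valid_seen_after:
  assumes "valid_seen seen"
  shows "valid_seen (seen_after seen t) \<and> set seen \<subseteq> set (seen_after seen t) \<and>
         t \<in> set (seen_after seen t) \<and>
         length (seen_after seen t) = length seen + size (new_spine seen t)"
  using assms
proof (induction t arbitrary: seen)
  case FLeaf
  then have "FLeaf \<in> set seen" by (rule valid_seenD)
  then show ?case using FLeaf by (simp add: known_subtree)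
next
  case (FNode l r)
  show ?case
  proof (cases "FNode l r \<in> set seen")
    case True
    then show ?thesis using FNode.prems by (simp add: known_subtree)
  next
    case False
    define s1 where "s1 = seen_after seen l"
    define s2 where "s2 = seen_after s1 r"
    have 1: "valid_seen s1" "set seen \<subseteq> set s1" "l \<in> set s1"
      "length s1 = length seen + size (new_spine seen l)"
      using FNode.IH(1)[OF FNode.prems, folded s1_def] by blast+
    have 2: "valid_seen s2" "set s1 \<subseteq> set s2" "r \<in> set s2"
      "length s2 = length s1 + size (new_spine s1 r)"
      using FNode.IH(2)[OF 1(1), folded s2_def] by blast+
    have "FNode l r \<notin> set s1"
      using False seen_after_size[of "FNode l r" seen l, folded s1_def] by force
    then have "FNode l r \<notin> set s2"
      using seen_after_size[of "FNode l r" s1 r, folded s2_def] by force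
    then have "valid_seen (s2 @ [FNode l r])"
      using 1(3) 2(1-3) by (blast intro: valid_seen_snoc)
    moreover have "seen_after seen (FNode l r) = s2 @ [FNode l r]"
      by (simp add: False seen_after_FNode s1_def s2_def)
    moreover have "size (new_spine seen (FNode l r))
        = Suc (size (new_spine seen l) + size (new_spine s1 r))"
      by (simp add: False new_spine_FNode s1_def)
    moreover have "set seen \<subseteq> set s2" using 1(2) 2(2) by blast
    ultimately show ?thesis using 1(4) 2(4) by auto
  qed
qed

section \<open>Trees adding a given number of nodes within a bound on right depths\<close>

definition extensions :: "full_tree list \<Rightarrow> nat \<Rightarrow> nat \<Rightarrow> full_tree set" where
  "extensions seen h n =
     {t. size (new_spine seen t) = n \<and> right_depths (new_spine seen t) \<subseteq> {..<h}}"

lemma right_depths_Node_subset: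
  "right_depths (Node l x r) \<subseteq> {..<Suc h} \<longleftrightarrow>
   right_depths l \<subseteq> {..<Suc h} \<and> right_depths r \<subseteq> {..<h}"
  by auto

lemma extensions_0:
  assumes "valid_seen seen"
  shows "extensions seen h 0 = set seen"
  using new_spine_eq_Leaf_iff[OF valid_seenD(2)[OF assms]]
  by (auto simp: extensions_def known_subtree)

lemma extensions_height_0: "extensions seen 0 (Suc n) = {}"
proof -
  have "right_depths t \<noteq> {}" if "size t = Suc n" for t :: "unit tree"
    using that by (cases t) auto
  then show ?thesis by (auto simp: extensions_def)
qed

text \<open>The root uses one node, a left edge keeps the depth bound and a right edge lowers it by
  one. Pairs forming a known node are removed, since such a node would become a pointer.\<close>

lemma extensions_Suc:
  assumes "valid_seen seen"
  shows "extensions seen (Suc h) (Suc n) =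
    (\<lambda>(l, r). FNode l r) ` (\<Union>i\<le>n. SIGMA l : extensions seen (Suc h) i.
        extensions (seen_after seen l) h (n - i)) - set seen" (is "?A = ?f ` ?P - _")
proof (intro subset_antisym subsetI)
  fix t assume t: "t \<in> ?A"
  have "t \<notin> set seen"
    using t known_subtree(1)[of t seen] by (auto simp: extensions_def)
  moreover obtain l r where lr: "t = FNode l r"
    using valid_seenD(2)[OF assms] \<open>t \<notin> set seen\<close> by (cases t) auto
  ultimately have "(l, r) \<in> ?P"
    using t by (force simp: extensions_def new_spine_FNode right_depths_Node_subset
        simp del: right_depths.simps)
  then show "t \<in> ?f ` ?P - set seen" using lr \<open>t \<notin> set seen\<close> by force
next
  fix t assume t: "t \<in> ?f ` ?P - set seen"
  then obtain l r i where "t = FNode l r" "i \<le> n" "l \<in> extensions seen (Suc h) i"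
    "r \<in> extensions (seen_after seen l) h (n - i)" by auto
  then show "t \<in> ?A"
    using t unfolding extensions_def mem_Collect_eq
    by (simp add: new_spine_FNode right_depths_Node_subset del: right_depths.simps)
qed

text \<open>The index \<open>h\<close> is one more than the right height, so that \<open>h = 0\<close> forces an empty spine.\<close>

function num_ext :: "nat \<Rightarrow> nat \<Rightarrow> nat \<Rightarrow> real" where
  "num_ext h k 0 = real k + 1"
| "num_ext 0 k (Suc n) = 0"
| "num_ext (Suc h) k (Suc n) =
     (\<Sum>i\<le>n. num_ext (Suc h) k i * num_ext h (k + i) (n - i)) - (if n = 0 then real k else 0)"
  by pat_completeness auto
termination by (relation "measure (\<lambda>(h, k, n). n)") auto

text \<open>The count depends on \<open>seen\<close> only through its length. Every left child with
  \<open>i\<close> new nodes leaves \<open>k + i\<close> known internal nodes, so all of them admit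
  equally many right children.\<close>

lemma card_extensions:
  assumes "valid_seen seen" "length seen = Suc k"
  shows "finite (extensions seen h n) \<and> real (card (extensions seen h n)) = num_ext h k n"
  using assms
proof (induction n arbitrary: seen h k rule: less_induct)
  case (less n)
  have card_seen: "card (set seen) = Suc k"
    using less.prems valid_seenD(1) by (metis distinct_card)
  show ?case
  proof (cases n)
    case 0
    then show ?thesis using less.prems card_seen by (simp add: extensions_0)
  next
    case n: (Suc m)
    show ?thesis
    proof (cases h)
      case 0
      then show ?thesis using n by (simp add: extensions_height_0)
    next
      case h: (Suc h')
      define E where "E i = extensions seen h i" for i
      define R where "R i l = extensions (seen_after seen l) h' (m - i)" for i l
      define P where "P = (\<Union>i\<le>m. Sigma (E i) (R i))"
      have E: "finite (E i)" "real (card (E i)) = num_ext h k i" if "i \<le> m" for i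
        using less.IH[of i seen k h] less.prems that n by (auto simp: E_def)
      have R: "finite (R i l)" "real (card (R i l)) = num_ext h' (k + i) (m - i)"
        if "i \<le> m" "l \<in> E i" for i l
      proof -
        have "valid_seen (seen_after seen l)" "length (seen_after seen l) = Suc (k + i)"
          using valid_seen_after[OF less.prems(1), of l] less.prems(2) that(2)
          by (auto simp: E_def extensions_def)
        then show "finite (R i l)" "real (card (R i l)) = num_ext h' (k + i) (m - i)"
          using less.IH[of "m - i" _ "k + i" h'] that n by (auto simp: R_def)
      qed
      have finP: "finite P"
        using E R by (auto simp: P_def intro!: finite_SigmaI)
      have "card P = (\<Sum>i\<le>m. card (Sigma (E i) (R i)))"
        unfolding P_def
      proof (rule card_UN_disjoint)
        show "\<forall>i\<in>{..m}. finite (Sigma (E i) (R i))"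
          using E R by (auto intro!: finite_SigmaI)
        \<comment> \<open>The left component determines \<open>i\<close> as the size of its new
          spine.\<close>
        show "\<forall>i\<in>{..m}. \<forall>j\<in>{..m}. i \<noteq> j \<longrightarrow> Sigma (E i) (R i) \<inter> Sigma (E j) (R j) = {}"
          by (auto simp: E_def extensions_def)
      qed simp
      then have "real (card P) = (\<Sum>i\<le>m. real (card (Sigma (E i) (R i))))"
        by simp
      also have "\<dots> = (\<Sum>i\<le>m. num_ext h k i * num_ext h' (k + i) (m - i))"
      proof (rule sum.cong[OF refl])
        fix i assume i: "i \<in> {..m}"
        have "real (card (Sigma (E i) (R i))) = (\<Sum>l\<in>E i. real (card (R i l)))"
          using E R i by (subst card_SigmaI) auto
        also have "\<dots> = (\<Sum>l\<in>E i. num_ext h' (k + i) (m - i))"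
          using R i by (intro sum.cong) auto
        finally show "real (card (Sigma (E i) (R i))) = num_ext h k i * num_ext h' (k + i) (m - i)"
          using E(2)[of i] i by simp
      qed
      finally have cardP:
        "real (card P) = (\<Sum>i\<le>m. num_ext h k i * num_ext h' (k + i) (m - i))" .
      let ?f = "\<lambda>(l, r). FNode l r"
      have inj: "inj_on ?f P" by (auto simp: inj_on_def)
      \<comment> \<open>Both children of a known node are known and add nothing, so it is hit only
        for \<open>m = 0\<close>; then all \<open>k\<close> known internal nodes are hit.\<close>
      have known: "?f ` P \<inter> set seen = (if m = 0 then set seen - {FLeaf} else {})"
      proof -
        have *: "(l, r) \<in> P \<longleftrightarrow> m = 0" if "FNode l r \<in> set seen" for l r
        proof -
          have "l \<in> set seen" "r \<in> set seen"
            using that valid_seenD(3,4)[OF less.prems(1)] by blast+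
          then show ?thesis
            by (auto simp: P_def E_def R_def extensions_def known_subtree)
        qed
        have "t \<in> ?f ` P \<longleftrightarrow> m = 0 \<and> t \<noteq> FLeaf" if "t \<in> set seen" for t
          using * that by (cases t) auto
        then show ?thesis by auto
      qed
      have "card (?f ` P \<inter> set seen) = (if m = 0 then k else 0)"
        using known card_seen valid_seenD(2)[OF less.prems(1)] by simp
      moreover have "card (?f ` P) = card (?f ` P - set seen) + card (?f ` P \<inter> set seen)"
        using finP by (metis card_Diff_subset_Int card_mono finite_Int finite_imageI inf_le1
            le_add_diff_inverse2)
      ultimately have "real (card (?f ` P - set seen)) = real (card P) - (if m = 0 then k else 0)"
        using card_image[OF inj] by auto
      moreover have "extensions seen h n = ?f ` P - set seen"
        using extensions_Suc[OF less.prems(1), of h' m]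
        unfolding P_def E_def R_def h n .
      ultimately show ?thesis using finP cardP by (simp add: h n)
    qed
  qed
qed

text \<open>Injectivity of compaction allows counting trees; initially only the leaf is known,
  whence \<open>k = 0\<close> in \<open>num_ext\<close>.\<close>

lemma compacted_count_eq: "real (compacted_count k n) = num_ext (Suc k) 0 n"
proof -
  have "{c \<in> range compact_tree. csize c = n \<and> right_height c \<le> k}
      = compact_tree ` extensions [FLeaf] (Suc k) n"
    using start_with_leaf
    by (auto simp: extensions_def right_height_le_iff compact_tree_def new_spine_def
        simp flip: size_spine)
  moreover have "inj compact_tree"
    by (auto simp: inj_def compact_tree_def intro: fst_compact_aux_inj)
  ultimately have "compacted_count k n = card (extensions [FLeaf] (Suc k) n)"
    by (simp add: compacted_count_def card_image inj_on_subset)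
  then show ?thesis
    using card_extensions[of "[FLeaf]" 0 "Suc k" n] by (simp add: valid_seen_def)
qed


section \<open>Elimination of the auxiliary operators\<close>

text \<open>On exponential generating functions this is the operator \<open>A (h - 1)\<close>.\<close>

definition ext_op :: "nat \<Rightarrow> (nat \<Rightarrow> real) \<Rightarrow> nat \<Rightarrow> real" where
  "ext_op h a n = (\<Sum>i\<le>n. a i * num_ext h i (n - i))"

text \<open>No node may be added, which leaves a pointer to one of \<open>n + 1\<close> targets:
  this is \<open>1 + z D\<close>.\<close>

lemma ext_op_0: "ext_op 0 a n = (real n + 1) * a n"
proof -
  have "ext_op 0 a n = (\<Sum>i\<le>n. if i = n then a i * (real i + 1) else 0)"
    unfolding ext_op_def
  proof (rule sum.cong[OF refl])
    fix i assume "i \<in> {..n}"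
    then show "a i * num_ext 0 i (n - i) = (if i = n then a i * (real i + 1) else 0)"
      by (cases "n - i") auto
  qed
  then show ?thesis by simp
qed

text \<open>Coefficient form of \<open>(D - A (h - 1)) A h = D + D z D - z D\<close>. Adding no node
  gives the first term. Otherwise the root is peeled off, and summing first over the number
  \<open>j\<close> of internal nodes known after the left child nests the operators.\<close>

lemma ext_op_Suc:
  "ext_op (Suc h) a (Suc n) =
     (real n + 2) * a (Suc n) + ext_op h (ext_op (Suc h) a) n - real n * a n"
proof -
  define N where "N = num_ext (Suc h)"
  have step: "N i (Suc n - i) = (\<Sum>j=i..n. N i (j - i) * num_ext h j (n - j))
      - (if i = n then real n else 0)" if "i \<le> n" for i
  proof -
    have "(\<Sum>j\<le>n-i. N i j * num_ext h (i + j) (n - i - j))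
        = (\<Sum>j=i..n. N i (j - i) * num_ext h j (n - j))"
      using that
      by (intro sum.reindex_bij_witness[of _ "\<lambda>j. j - i" "\<lambda>j. i + j"]) auto
    then show ?thesis using that by (auto simp: N_def Suc_diff_le)
  qed
  have "ext_op (Suc h) a (Suc n)
      = (real n + 2) * a (Suc n) + (\<Sum>i\<le>n. a i * N i (Suc n - i))"
    by (simp add: ext_op_def N_def algebra_simps)
  also have "(\<Sum>i\<le>n. a i * N i (Suc n - i))
      = (\<Sum>i\<le>n. (\<Sum>j=i..n. a i * (N i (j - i) * num_ext h j (n - j)))
          - (if i = n then real n * a n else 0))"
    by (intro sum.cong) (auto simp: step sum_distrib_left algebra_simps)
  also have "\<dots> = (\<Sum>i\<le>n. \<Sum>j=i..n. a i * (N i (j - i) * num_ext h j (n - j))) - real n * a n"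
    by (simp add: sum_subtractf)
  also have "(\<Sum>i\<le>n. \<Sum>j=i..n. a i * (N i (j - i) * num_ext h j (n - j)))
      = (\<Sum>j\<le>n. \<Sum>i\<le>j. a i * (N i (j - i) * num_ext h j (n - j)))"
    unfolding sum.Sigma[OF finite_atMost ballI[OF finite_atLeastAtMost]]
      sum.Sigma[OF finite_atMost ballI[OF finite_atMost]]
    by (intro sum.reindex_bij_witness[of _ prod.swap prod.swap]) auto
  also have "\<dots> = ext_op h (ext_op (Suc h) a) n"
    by (simp add: ext_op_def N_def sum_distrib_right mult.assoc)
  finally show ?thesis by simp
qed

text \<open>With no internal node known, no pair is forbidden. For \<open>h = 2\<close> this is
  \<open>C2' = A 1 C2\<close>.\<close>

lemma num_ext_Suc_0: "num_ext (Suc h) 0 (Suc n) = ext_op h (num_ext (Suc h) 0) n"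
  by (simp add: ext_op_def)

section \<open>Recurrence and differential equation for right height at most 2\<close>

lemma compacted_count_2_rec:
  defines "a \<equiv> \<lambda>n. real (compacted_count 2 n)"
  shows "a (n + 3) = (3 * real n + 6) * a (n + 2) - ((real n)\<^sup>2 + 5 * real n + 3) * a (n + 1)
           + real n * (real n + 1) * a n"
proof -
  have a: "a = num_ext 3 0"
    by (rule ext) (simp add: a_def compacted_count_eq)
  \<comment> \<open>Since \<open>A 1\<close> merely shifts \<open>a\<close>, the only unknown is
    \<open>e\<close>, the image of \<open>a\<close> under \<open>A 0\<close> after
    \<open>A 1\<close>. It is solved for in \<open>e1\<close> and advanced by one index in
    \<open>e2\<close>, where \<open>A (-1)\<close> is explicit.\<close>
  define e where "e = ext_op 1 (ext_op 2 a)"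
  have shift: "ext_op 2 a m = a (Suc m)" for m
    using num_ext_Suc_0[of 2 m] by (simp add: a)
  have e1: "a (m + 2) = (real m + 2) * a (m + 1) + e m - real m * a m" for m
    using ext_op_Suc[of 1 a m] shift[of "Suc m"] by (simp add: e_def numeral_2_eq_2)
  have e2: "e (Suc n) = (real n + 2) * a (n + 2) + (real n + 1) * e n - real n * a (n + 1)"
    using ext_op_Suc[of 0 "ext_op 2 a" n] by (simp add: e_def ext_op_0 shift)
  have e: "e n = a (n + 2) - (real n + 2) * a (n + 1) + real n * a n"
    using e1[of n] by simp
  have "a (n + 3) = (real n + 3) * a (n + 2) + e (Suc n) - (real n + 1) * a (n + 1)"
    using e1[of "Suc n"] by (simp add: eval_nat_numeral algebra_simps)
  then show ?thesis
    unfolding e2 e by (simp add: algebra_simps power2_eq_square)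
qed

lemma compacted_count_2_initial:
  "compacted_count 2 0 = 1" "compacted_count 2 (Suc 0) = 1" "compacted_count 2 (Suc (Suc 0)) = 3"
proof -
  have "real (compacted_count 2 0) = 1" "real (compacted_count 2 (Suc 0)) = 1"
    "real (compacted_count 2 (Suc (Suc 0))) = 3"
    by (simp_all add: compacted_count_eq eval_nat_numeral)
  then show "compacted_count 2 0 = 1" "compacted_count 2 (Suc 0) = 1"
    "compacted_count 2 (Suc (Suc 0)) = 3" by linarith+
qed

text \<open>The \<open>n\<close>-th coefficient times \<open>fact n\<close> is the recurrence for
  the counts.\<close>

lemma compacted_egf_2_ode:
  defines "C2 \<equiv> compacted_egf 2"
  shows "(fps_X ^ 2 - 3 * fps_X + 1) * fps_deriv (fps_deriv (fps_deriv C2))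
         - (fps_X ^ 2 - 6 * fps_X + 6) * fps_deriv (fps_deriv C2)
         - (2 * fps_X - 3) * fps_deriv C2 = 0" (is "?L = 0")
proof (rule fps_ext)
  fix n
  define a where "a = (\<lambda>n. real (compacted_count 2 n))"
  define C1 D2 D3 where "C1 = fps_deriv C2" and "D2 = fps_deriv C1" and "D3 = fps_deriv D2"
  have C1: "fps_nth C1 m = a (m + 1) / fact m" for m
    by (simp add: C1_def C2_def compacted_egf_def a_def field_simps del: of_nat_Suc)
  have D2: "fps_nth D2 m = a (m + 2) / fact m" for m
    by (simp add: D2_def C1 field_simps del: of_nat_Suc)
  have D3: "fps_nth D3 m = a (m + 3) / fact m" for m
    by (simp add: D3_def D2 eval_nat_numeral field_simps del: of_nat_Suc)
  \<comment> \<open>Truncation in \<open>n - 1\<close>, and in \<open>n - 2\<close> below, is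
    harmless because the factor in front vanishes there.\<close>
  have X1: "fps_nth (fps_X * f) n * fact n = real n * b (n - 1)"
    if "\<And>m. fps_nth f m = b m / fact m" for f :: "real fps" and b
    by (cases n) (auto simp: that field_simps)
  have X2: "fps_nth (fps_X ^ 2 * f) n * fact n = real n * (real n - 1) * b (n - 2)"
    if "\<And>m. fps_nth f m = b m / fact m" for f :: "real fps" and b
  proof -
    consider "n = 0" | "n = 1" | m where "n = Suc (Suc m)" by (metis One_nat_def not0_implies_Suc)
    then show ?thesis
    proof cases
      case (3 m)
      then have "fps_nth (fps_X ^ 2 * f) n = fps_nth f m"
        by (simp add: power2_eq_square mult.assoc)
      then have "fps_nth (fps_X ^ 2 * f) n = b m / fact m" by (simp only: that)
      then show ?thesis unfolding 3 by simp
    qed (simp_all add: power2_eq_square mult.assoc)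
  qed
  have L: "?L = fps_X ^ 2 * D3 - 3 * (fps_X * D3) + D3 - fps_X ^ 2 * D2 + 6 * (fps_X * D2) - 6 * D2
      - 2 * (fps_X * C1) + 3 * C1"
    by (simp add: C1_def D2_def D3_def algebra_simps)
  have "fps_nth ?L n * fact n = fps_nth (fps_X ^ 2 * D3) n * fact n
      - 3 * (fps_nth (fps_X * D3) n * fact n) + fps_nth D3 n * fact n
      - fps_nth (fps_X ^ 2 * D2) n * fact n + 6 * (fps_nth (fps_X * D2) n * fact n)
      - 6 * (fps_nth D2 n * fact n)
      - 2 * (fps_nth (fps_X * C1) n * fact n) + 3 * (fps_nth C1 n * fact n)"
    unfolding L unfolding numeral_fps_const fps_sub_nth fps_add_nth fps_mult_left_const_nth
    by (simp only: algebra_simps)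
  also have "\<dots> = real n * (real n - 1) * a (n - 2 + 3) - 3 * (real n * a (n - 1 + 3)) + a (n + 3)
      - real n * (real n - 1) * a (n - 2 + 2) + 6 * (real n * a (n - 1 + 2)) - 6 * a (n + 2)
      - 2 * (real n * a (n - 1 + 1)) + 3 * a (n + 1)"
    by (simp only: X1[OF C1] X1[OF D2] X1[OF D3] X2[OF D2] X2[OF D3]) (simp add: C1 D2 D3)
  also have "\<dots> = 0"
  proof -
    have rec: "a (n + 3) = (3 * real n + 6) * a (n + 2) - ((real n)\<^sup>2 + 5 * real n + 3) * a (n + 1)
        + real n * (real n + 1) * a n"
      unfolding a_def by (rule compacted_count_2_rec)
    consider "n = 0" | "n = 1" | "n \<ge> 2" by linarith
    then show ?thesis
    proof cases
      case 3
      then have "n - 2 + 3 = n + 1" "n - 2 + 2 = n" "n - 1 + 3 = n + 2" "n - 1 + 2 = n + 1"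
        "n - 1 + 1 = n" by linarith+
      then show ?thesis
        using rec by (simp only:) (simp add: algebra_simps power2_eq_square)
    qed (use rec in \<open>simp_all add: eval_nat_numeral\<close>)
  qed
  finally show "fps_nth ?L n = fps_nth 0 n" by simp
qed

theorem mainTheorem16:
  defines "C2 \<equiv> compacted_egf 2"
  shows "D_finite C2 \<and>
         (fps_X ^ 2 - 3 * fps_X + 1) * fps_deriv (fps_deriv (fps_deriv C2))
         - (fps_X ^ 2 - 6 * fps_X + 6) * fps_deriv (fps_deriv C2)
         - (2 * fps_X - 3) * fps_deriv C2 = 0 \<and>
         fps_nth C2 0 = 1 \<and>
         fps_nth (fps_deriv C2) 0 = 1 \<and>
         fps_nth (fps_deriv (fps_deriv C2)) 0 = 3"
proof (intro conjI)
  define X :: "real poly" where "X = [:0, 1:]"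
  \<comment> \<open>Coefficients by order of derivative; entry 0 vanishes as the equation has no
    term in \<open>C2\<close> itself.\<close>
  define p where "p = (\<lambda>i. [0, - (2 * X - 3), - (X ^ 2 - 6 * X + 6), X ^ 2 - 3 * X + 1] ! i)"
  have X: "fps_of_poly X = fps_X" by (simp add: X_def fps_of_poly_pCons)
  have "fps_of_poly (p 0) = 0" "fps_of_poly (p 1) = - (2 * fps_X - 3)"
    "fps_of_poly (p 2) = - (fps_X ^ 2 - 6 * fps_X + 6)"
    "fps_of_poly (p 3) = fps_X ^ 2 - 3 * fps_X + 1"
    by (simp_all add: p_def X fps_of_poly_simps)
  moreover have "(\<Sum>i\<le>3. f i) = f 0 + f 1 + f 2 + f 3" for f :: "nat \<Rightarrow> real fps"
    by (simp add: eval_nat_numeral)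
  moreover have "(fps_deriv ^^ 1) C2 = fps_deriv C2"
    "(fps_deriv ^^ 2) C2 = fps_deriv (fps_deriv C2)"
    "(fps_deriv ^^ 3) C2 = fps_deriv (fps_deriv (fps_deriv C2))"
    by (simp_all add: eval_nat_numeral)
  ultimately have "(\<Sum>i\<le>3. fps_of_poly (p i) * (fps_deriv ^^ i) C2)
      = (fps_X ^ 2 - 3 * fps_X + 1) * fps_deriv (fps_deriv (fps_deriv C2))
         - (fps_X ^ 2 - 6 * fps_X + 6) * fps_deriv (fps_deriv C2)
         - (2 * fps_X - 3) * fps_deriv C2"
    by (simp only: funpow_0) (simp add: algebra_simps)
  then have "(\<Sum>i\<le>3. fps_of_poly (p i) * (fps_deriv ^^ i) C2) = 0"
    using compacted_egf_2_ode by (simp only: C2_def)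
  moreover have "poly (p 3) 0 = 1" by (simp add: p_def X_def)
  then have "p 3 \<noteq> 0" by force
  ultimately show "D_finite C2" unfolding D_finite_def by blast
qed (use compacted_egf_2_ode compacted_count_2_initial in
    \<open>simp_all add: C2_def compacted_egf_def\<close>)

end
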